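(* For every integer $n\geq 3$, the graph $G = K_{n-1}\odot K_{n} := (K_{n-1}\cup K_{n-2})\,\nabla\, K_1$, which has order $2n-2$, is $L$-borderenergetic and is $L$-noncospectral with the complete graph $K_{2n-2}$.
   Context: All graphs are finite, undirected, without loops or multiple edges. $K_m$ is the complete graph on $m$ vertices; $G_1\cup G_2$ is the disjoint union of graphs; the join $G_1\nabla G_2$ is the graph obtained from $G_1\cup G_2$ by joining every vertex of $G_1$ to every vertex of $G_2$. The Laplacian matrix is $L=D-A$ (diagonal degree matrix minus adjacency matrix). For a graph $G$ of order $N$ with Laplacian eigenvalues $\mu_1,\dots,\mu_N$ (with multiplicity) and average degree $\overline{d}$, the Laplacian energy is $E_L(G)=\sum_{i=1}^N|\mu_i-\overline{d}|$. A graph $G$ of order $N$ is $L$-borderenergetic if $E_L(G)=2N-2$ (which is the Laplacian energy of $K_N$). Two graphs are $L$-noncospectral if their Laplacian spectra (as multisets) are different. *)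

theory Defs
  imports
    "Graph_Theory.Kuratowski"
    "Jordan_Normal_Form.Char_Poly"
begin

text \<open>
  A finite simple undirected graph is a \<^locale>\<open>pair_graph\<close>: a finite, loop-free digraph
  without parallel arcs whose arc relation is symmetric. The undirected edge \<open>uv\<close> is the pair
  of arcs \<open>(u, v)\<close>, \<open>(v, u)\<close>, so the degree of a vertex is its out-degree.
\<close>

definition complete_graph :: "nat \<Rightarrow> nat pair_pre_digraph" where
  "complete_graph m =
    \<lparr> pverts = {..<m}, parcs = {(u, v). u < m \<and> v < m \<and> u \<noteq> v} \<rparr>"

definition disj_union ::
    "'a pair_pre_digraph \<Rightarrow> 'b pair_pre_digraph \<Rightarrow> ('a + 'b) pair_pre_digraph" where
  "disj_union G H =
    \<lparr> pverts = pverts G <+> pverts H,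
      parcs = map_prod Inl Inl ` parcs G \<union> map_prod Inr Inr ` parcs H \<rparr>"

definition join ::
    "'a pair_pre_digraph \<Rightarrow> 'b pair_pre_digraph \<Rightarrow> ('a + 'b) pair_pre_digraph" where
  "join G H =
    \<lparr> pverts = pverts (disj_union G H),
      parcs = parcs (disj_union G H)
        \<union> {(Inl u, Inr v) | u v. u \<in> pverts G \<and> v \<in> pverts H}
        \<union> {(Inr v, Inl u) | u v. u \<in> pverts G \<and> v \<in> pverts H} \<rparr>"

text \<open>The graph \<open>K\<^bsub>n-1\<^esub> \<odot> K\<^bsub>n\<^esub>\<close>, for \<open>n \<ge> 2\<close> (natural-number subtraction truncates).\<close>

definition complete_coalescence :: "nat \<Rightarrow> ((nat + nat) + nat) pair_pre_digraph" where
  "complete_coalescence n =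
    join (disj_union (complete_graph (n - 1)) (complete_graph (n - 2))) (complete_graph 1)"

definition graph_order :: "'a pair_pre_digraph \<Rightarrow> nat" where
  "graph_order G = card (pverts G)"

definition vertex_degree :: "'a pair_pre_digraph \<Rightarrow> 'a \<Rightarrow> nat" where
  "vertex_degree G v = out_degree (with_proj G) v"

definition average_degree :: "'a pair_pre_digraph \<Rightarrow> real" where
  "average_degree G = (\<Sum>v\<in>pverts G. real (vertex_degree G v)) / real (graph_order G)"

definition vertex_enum :: "'a pair_pre_digraph \<Rightarrow> 'a list \<Rightarrow> bool" where
  "vertex_enum G vs \<longleftrightarrow> distinct vs \<and> set vs = pverts G"

text \<open>Row and column \<open>i\<close> of the following matrices belong to the vertex \<open>vs ! i\<close>.\<close>

definition degree_matrix :: "'a list \<Rightarrow> 'a pair_pre_digraph \<Rightarrow> real mat" where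
  "degree_matrix vs G =
    mat (length vs) (length vs) (\<lambda>(i, j). if i = j then real (vertex_degree G (vs ! i)) else 0)"

definition adjacency_matrix :: "'a list \<Rightarrow> 'a pair_pre_digraph \<Rightarrow> real mat" where
  "adjacency_matrix vs G =
    mat (length vs) (length vs) (\<lambda>(i, j). if (vs ! i, vs ! j) \<in> parcs G then 1 else 0)"

definition laplacian_matrix :: "'a list \<Rightarrow> 'a pair_pre_digraph \<Rightarrow> real mat" where
  "laplacian_matrix vs G = degree_matrix vs G - adjacency_matrix vs G"

text \<open>
  The multiset of eigenvalues, counted with algebraic multiplicity. For a \<^locale>\<open>pair_graph\<close>
  the Laplacian matrix is real symmetric, so all its complex eigenvalues are real and none is
  missed by taking real roots. The choice of the enumeration is immaterial by
  \<open>laplacian_spectrum_eq\<close> below.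
\<close>

definition laplacian_spectrum :: "'a pair_pre_digraph \<Rightarrow> real multiset" where
  "laplacian_spectrum G =
    proots (char_poly (laplacian_matrix (SOME vs. vertex_enum G vs) G))"

definition laplacian_energy :: "'a pair_pre_digraph \<Rightarrow> real" where
  "laplacian_energy G = (\<Sum>\<mu>\<in>#laplacian_spectrum G. \<bar>\<mu> - average_degree G\<bar>)"

definition L_borderenergetic :: "'a pair_pre_digraph \<Rightarrow> bool" where
  "L_borderenergetic G \<longleftrightarrow> laplacian_energy G = 2 * real (graph_order G) - 2"

definition L_noncospectral :: "'a pair_pre_digraph \<Rightarrow> 'b pair_pre_digraph \<Rightarrow> bool" where
  "L_noncospectral G H \<longleftrightarrow> laplacian_spectrum G \<noteq> laplacian_spectrum H"


lemma pair_graphI: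
  assumes "finite (pverts G)" "parcs G \<subseteq> pverts G \<times> pverts G"
    and "\<And>u v. (u, v) \<in> parcs G \<Longrightarrow> (v, u) \<in> parcs G" "\<And>u. (u, u) \<notin> parcs G"
  shows "pair_graph G"
proof
  show "finite (parcs G)"
    using assms(1,2) by (meson finite_SigmaI finite_subset)
  show "symmetric (with_proj G)"
    using assms(3) by (auto simp: symmetric_def intro: symI)
qed (use assms in auto)

lemma pair_graph_props:
  assumes "pair_graph G"
  shows "finite (pverts G)" "\<And>u v. (u, v) \<in> parcs G \<Longrightarrow> u \<in> pverts G \<and> v \<in> pverts G"
    and "\<And>u v. (u, v) \<in> parcs G \<Longrightarrow> (v, u) \<in> parcs G" "\<And>u. (u, u) \<notin> parcs G"
proof -
  interpret pair_graph G by fact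
  show "finite (pverts G)" by (rule pair_finite_verts)
  show "u \<in> pverts G \<and> v \<in> pverts G" if "(u, v) \<in> parcs G" for u v
    using arc_fst_in_verts[OF that] arc_snd_in_verts[OF that] by simp
  show "(v, u) \<in> parcs G" if "(u, v) \<in> parcs G" for u v
    using pair_sym_arcs that by (auto simp: symmetric_def elim: symE)
  show "(u, u) \<notin> parcs G" for u
    using pair_no_loops by fastforce
qed

lemma pair_graph_complete_graph: "pair_graph (complete_graph m)"
  by (rule pair_graphI) (auto simp: complete_graph_def)

lemma complete_digraph_complete_graph: "complete_digraph m (with_proj (complete_graph m))"
  unfolding complete_digraph_pair_def by (auto simp: complete_graph_def)

lemma pair_graph_disj_union:
  assumes "pair_graph G" "pair_graph H"
  shows "pair_graph (disj_union G H)"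
  using pair_graph_props[OF assms(1)] pair_graph_props[OF assms(2)]
  by (intro pair_graphI) (fastforce simp: disj_union_def)+

lemma pair_graph_join:
  assumes "pair_graph G" "pair_graph H"
  shows "pair_graph (join G H)"
  using pair_graph_props[OF pair_graph_disj_union[OF assms]]
  by (intro pair_graphI) (auto simp: join_def, auto simp: disj_union_def)

lemma pair_graph_complete_coalescence: "pair_graph (complete_coalescence n)"
  unfolding complete_coalescence_def
  by (intro pair_graph_join pair_graph_disj_union pair_graph_complete_graph)

lemma char_poly_laplacian_matrix_enum:
  assumes vs: "vertex_enum G vs" and ws: "vertex_enum G ws"
  shows "char_poly (laplacian_matrix vs G) = char_poly (laplacian_matrix ws G)"
proof -
  define N where "N = length vs"
  have N: "length ws = N"
    using vs ws unfolding vertex_enum_def N_def by (metis distinct_card)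
  define l where "l u v = (if u = v then real (vertex_degree G u) else 0)
      - (if (u, v) \<in> parcs G then 1 else 0)" for u v
  define p where "p us xs = mat N N (\<lambda>(i, j). if us ! i = xs ! j then 1 else (0::real))"
    for us xs :: "'a list"
  have en: "distinct vs" "distinct ws" "set ws = set vs" "length vs = N"
    using vs ws by (auto simp: vertex_enum_def N_def)
  have lap: "laplacian_matrix us G = mat N N (\<lambda>(i, j). l (us ! i) (us ! j))"
    if "distinct us" "length us = N" for us
    using that by (intro eq_matI)
      (auto simp: laplacian_matrix_def degree_matrix_def adjacency_matrix_def l_def
        nth_eq_iff_index_eq)
  have pick: "(\<Sum>k<N. if u = us ! k then f (us ! k) else 0) = f u"
    "(\<Sum>k<N. if us ! k = u then f (us ! k) else 0) = f u"
    if "distinct us" "length us = N" "u \<in> set us" for us u and f :: "'a \<Rightarrow> real"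
  proof -
    have "(\<Sum>k<N. if us ! k = u then f (us ! k) else 0)
        = (\<Sum>x\<in>set us. if x = u then f x else 0)"
      using bij_betw_nth[OF that(1) refl refl] that(2)
      by (subst sum.reindex_bij_betw[symmetric, where h = "nth us" and S = "{..<N}"]) auto
    then show "(\<Sum>k<N. if us ! k = u then f (us ! k) else 0) = f u"
      using that(3) by simp
    then show "(\<Sum>k<N. if u = us ! k then f (us ! k) else 0) = f u"
      by (subst eq_commute[of u])
  qed
  have pm: "p us xs * mat N N (\<lambda>(i, j). m (xs ! i) (ys ! j))
      = mat N N (\<lambda>(i, j). m (us ! i) (ys ! j))"
    if "distinct xs" "length xs = N" "length us = N" "set us = set xs"
    for us xs ys :: "'a list" and m :: "'a \<Rightarrow> 'a \<Rightarrow> real"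
  proof (intro eq_matI)
    fix i j assume *: "i < dim_row (mat N N (\<lambda>(i, j). m (us ! i) (ys ! j)))"
      "j < dim_col (mat N N (\<lambda>(i, j). m (us ! i) (ys ! j)))"
    then have u: "us ! i \<in> set xs" using that by (metis dim_row_mat(1) nth_mem)
    have "(p us xs * mat N N (\<lambda>(i, j). m (xs ! i) (ys ! j))) $$ (i, j)
        = (\<Sum>k<N. (if us ! i = xs ! k then 1 else 0) * m (xs ! k) (ys ! j))"
      using * by (simp add: p_def scalar_prod_def atLeast0LessThan)
    also have "\<dots> = (\<Sum>k<N. if us ! i = xs ! k then m (xs ! k) (ys ! j) else 0)"
      by (rule sum.cong) simp_all
    also have "\<dots> = m (us ! i) (ys ! j)"
      by (rule pick(1)[OF that(1,2) u])
    finally show "(p us xs * mat N N (\<lambda>(i, j). m (xs ! i) (ys ! j))) $$ (i, j)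
        = mat N N (\<lambda>(i, j). m (us ! i) (ys ! j)) $$ (i, j)"
      using * by simp
  qed (simp_all add: p_def)
  have mp: "mat N N (\<lambda>(i, j). m (xs ! i) (us ! j)) * p us ys
      = mat N N (\<lambda>(i, j). m (xs ! i) (ys ! j))"
    if "distinct us" "length us = N" "length ys = N" "set us = set ys"
    for us xs ys :: "'a list" and m :: "'a \<Rightarrow> 'a \<Rightarrow> real"
  proof (intro eq_matI)
    fix i j assume *: "i < dim_row (mat N N (\<lambda>(i, j). m (xs ! i) (ys ! j)))"
      "j < dim_col (mat N N (\<lambda>(i, j). m (xs ! i) (ys ! j)))"
    then have u: "ys ! j \<in> set us" using that by (metis dim_col_mat(1) nth_mem)
    have "(mat N N (\<lambda>(i, j). m (xs ! i) (us ! j)) * p us ys) $$ (i, j)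
        = (\<Sum>k<N. m (xs ! i) (us ! k) * (if us ! k = ys ! j then 1 else 0))"
      using * by (simp add: p_def scalar_prod_def atLeast0LessThan)
    also have "\<dots> = (\<Sum>k<N. if us ! k = ys ! j then m (xs ! i) (us ! k) else 0)"
      by (rule sum.cong) simp_all
    also have "\<dots> = m (xs ! i) (ys ! j)"
      by (rule pick(2)[OF that(1,2) u])
    finally show "(mat N N (\<lambda>(i, j). m (xs ! i) (us ! j)) * p us ys) $$ (i, j)
        = mat N N (\<lambda>(i, j). m (xs ! i) (ys ! j)) $$ (i, j)"
      using * by simp
  qed (simp_all add: p_def)
  have one: "p us us = 1\<^sub>m N" if "distinct us" "length us = N" for us
    using that by (intro eq_matI) (auto simp: p_def nth_eq_iff_index_eq)
  have pp: "p us xs * p xs us = 1\<^sub>m N"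
    if "distinct us" "distinct xs" "length us = N" "length xs = N" "set us = set xs" for us xs
    using pm[OF that(2,4,3,5), of "\<lambda>x y. if x = y then 1 else 0" us] one[OF that(1,3)]
    by (simp add: p_def)
  have "similar_mat (laplacian_matrix vs G) (laplacian_matrix ws G)"
  proof (rule similar_matI)
    show "{laplacian_matrix vs G, laplacian_matrix ws G, p vs ws, p ws vs} \<subseteq> carrier_mat N N"
      using en N by (simp add: lap p_def)
    show "p vs ws * p ws vs = 1\<^sub>m N" "p ws vs * p vs ws = 1\<^sub>m N"
      by (rule pp; simp add: en N)+
    show "laplacian_matrix vs G = p vs ws * laplacian_matrix ws G * p ws vs"
      using en N by (simp add: lap pm mp)
  qed
  then show ?thesis by (rule char_poly_similar)
qed

lemma laplacian_spectrum_eq: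
  assumes "vertex_enum G vs"
  shows "laplacian_spectrum G = proots (char_poly (laplacian_matrix vs G))"
  unfolding laplacian_spectrum_def
  by (rule arg_cong[where f = proots], rule char_poly_laplacian_matrix_enum)
    (use assms in \<open>auto intro: someI\<close>)

end

theory Submission
  imports Defs
begin

text \<open>
  The whole Laplacian spectrum of \<open>G\<close> can be written down. The Laplacian of a disjoint union is
  block diagonal, so characteristic polynomials multiply. The Laplacian of a join of \<open>G\<close> (order
  \<open>g\<close>) and \<open>H\<close> (order \<open>h\<close>) has diagonal blocks \<open>L\<^sub>G + h I\<close> and \<open>L\<^sub>H + g I\<close> and all off-diagonal
  entries \<open>-1\<close>. As the all-ones vector is in the kernel of every Laplacian, the off-diagonal
  blocks only affect the two-dimensional space of vectors that are constant on each side: there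
  the eigenvalues \<open>h\<close> and \<open>g\<close> turn into \<open>0\<close> and \<open>g + h\<close>, and every other eigenvalue of \<open>G\<close> is
  shifted by \<open>h\<close>, every other eigenvalue of \<open>H\<close> by \<open>g\<close>. This is
  \<open>laplacian_char_poly_join\<close>. Together with the spectrum \<open>0, m, \<dots>, m\<close> of \<open>K\<^sub>m\<close> it gives

  \<open>0, 1, 2n - 2\<close>, \<open>n\<close> (\<open>n - 2\<close> times), \<open>n - 1\<close> (\<open>n - 3\<close> times)

  as the spectrum of \<open>(K\<^bsub>n-1\<^esub> \<union> K\<^bsub>n-2\<^esub>) \<nabla> K\<^sub>1\<close>. The average degree is \<open>n - 1\<close>, so the energy is
  \<open>(n - 1) + (n - 2) + (n - 1) + (n - 2) = 4n - 6 = 2 (2n - 2) - 2\<close>: the eigenvalue \<open>n - 1\<close>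
  contributes nothing. The eigenvalue \<open>1\<close> distinguishes the spectrum from the one of \<open>K\<^bsub>2n-2\<^esub>\<close>.

  Characteristic polynomials are compared only at points where no denominator vanishes; since
  polynomials that agree outside a finite set are equal, this determines the spectrum
  (\<open>laplacian_spectrum_eqI\<close>).
\<close>

section \<open>Determinants of all-ones perturbations\<close>

definition ones_mat :: "nat \<Rightarrow> nat \<Rightarrow> 'a :: comm_ring_1 mat" where
  "ones_mat n m = mat n m (\<lambda>_. 1)"

lemma ones_mat_carrier [simp, intro]: "ones_mat n m \<in> carrier_mat n m"
  by (simp add: ones_mat_def)

lemma ones_mat_dim [simp]: "dim_row (ones_mat n m) = n" "dim_col (ones_mat n m) = m"
  by (simp_all add: ones_mat_def)

lemma ones_mat_index [simp]: "i < n \<Longrightarrow> j < m \<Longrightarrow> ones_mat n m $$ (i, j) = 1"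
  by (simp add: ones_mat_def)

lemma ones_mat_mult: "ones_mat n k * ones_mat k m = of_nat k \<cdot>\<^sub>m ones_mat n m"
  by (intro eq_matI) (auto simp: scalar_prod_def)

text \<open>
  The rank-one case of Sylvester's identity \<open>det (I - u v\<^sup>T) = 1 - v\<^sup>T u\<close>: the bordered matrix
  \<open>M\<close> below is reduced to a block triangular matrix by clearing either of its off-diagonal blocks.
\<close>

lemma det_one_minus_ones:
  fixes c :: "'a :: idom"
  shows "det (1\<^sub>m n - c \<cdot>\<^sub>m ones_mat n n) = 1 - c * of_nat n"
proof -
  define M where "M = four_block_mat (1\<^sub>m n) (ones_mat n 1) (c \<cdot>\<^sub>m ones_mat 1 n) (1\<^sub>m 1)"
  define P where "P = four_block_mat (1\<^sub>m n) (0\<^sub>m n 1) (- c \<cdot>\<^sub>m ones_mat 1 n) (1\<^sub>m 1)"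
  define Q where "Q = four_block_mat (1\<^sub>m n) (- ones_mat n 1) (0\<^sub>m 1 n) (1\<^sub>m 1 :: 'a mat)"
  have carrier: "M \<in> carrier_mat (n + 1) (n + 1)" "P \<in> carrier_mat (n + 1) (n + 1)"
    "Q \<in> carrier_mat (n + 1) (n + 1)"
    unfolding M_def P_def Q_def by (intro four_block_carrier_mat; simp)+
  have "M * P = four_block_mat (1\<^sub>m n - c \<cdot>\<^sub>m ones_mat n n) (ones_mat n 1) (0\<^sub>m 1 n) (1\<^sub>m 1)"
    unfolding M_def P_def
    by (subst mult_four_block_mat[where ?nr1.0 = n and ?n1.0 = n and ?n2.0 = 1 and ?nr2.0 = 1
          and ?nc1.0 = n and ?nc2.0 = 1], simp_all, rule cong_four_block_mat)
      (auto intro!: eq_matI simp: scalar_prod_def)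
  moreover have "M * Q = four_block_mat (1\<^sub>m n) (0\<^sub>m n 1) (c \<cdot>\<^sub>m ones_mat 1 n)
      (mat 1 1 (\<lambda>_. 1 - c * of_nat n))"
    unfolding M_def Q_def
    by (subst mult_four_block_mat[where ?nr1.0 = n and ?n1.0 = n and ?n2.0 = 1 and ?nr2.0 = 1
          and ?nc1.0 = n and ?nc2.0 = 1], simp_all, rule cong_four_block_mat)
      (auto intro!: eq_matI simp: scalar_prod_def)
  moreover have "det P = 1"
    unfolding P_def by (subst det_four_block_mat_upper_right_zero[where n = n and m = 1]) auto
  moreover have "det Q = 1"
    unfolding Q_def by (subst det_four_block_mat_lower_left_zero[where n = n and m = 1]) auto
  ultimately have "det (four_block_mat (1\<^sub>m n - c \<cdot>\<^sub>m ones_mat n n) (ones_mat n 1) (0\<^sub>m 1 n) (1\<^sub>m 1))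
      = det (four_block_mat (1\<^sub>m n) (0\<^sub>m n 1) (c \<cdot>\<^sub>m ones_mat 1 n)
          (mat 1 1 (\<lambda>_. 1 - c * of_nat n)))"
    using det_mult[OF carrier(1,2)] det_mult[OF carrier(1,3)] by simp
  also have "\<dots> = 1 - c * of_nat n"
    by (subst det_four_block_mat_upper_right_zero[where n = n and m = 1]) (auto simp: det_single)
  also have "det (four_block_mat (1\<^sub>m n - c \<cdot>\<^sub>m ones_mat n n) (ones_mat n 1) (0\<^sub>m 1 n) (1\<^sub>m 1))
      = det (1\<^sub>m n - c \<cdot>\<^sub>m ones_mat n n)"
    by (subst det_four_block_mat_lower_left_zero[where n = n and m = 1]) (auto simp: minus_carrier_mat)
  finally show ?thesis .
qed

text \<open>
  Let \<open>J\<close> denote all-ones matrices. Constant row sums \<open>a\<close> make \<open>J = A (J / a)\<close>, so that \<open>A\<close>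
  factors out of \<open>A - c J\<close>.
\<close>

lemma det_minus_ones:
  fixes A :: "'a :: field mat"
  assumes A: "A \<in> carrier_mat n n" and A1: "A * ones_mat n n = a \<cdot>\<^sub>m ones_mat n n" and "a \<noteq> 0"
  shows "det (A - c \<cdot>\<^sub>m ones_mat n n) = det A * (1 - c * of_nat n / a)"
proof -
  have "A * (1\<^sub>m n - (c / a) \<cdot>\<^sub>m ones_mat n n) = A * 1\<^sub>m n - A * ((c / a) \<cdot>\<^sub>m ones_mat n n)"
    using A by (intro mult_minus_distrib_mat) auto
  also have "A * ((c / a) \<cdot>\<^sub>m ones_mat n n) = (c / a) \<cdot>\<^sub>m (A * ones_mat n n)"
    using A by (intro mult_smult_distrib) auto
  also have "\<dots> = c \<cdot>\<^sub>m ones_mat n n"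
    using \<open>a \<noteq> 0\<close> unfolding A1 by (intro eq_matI) auto
  finally have "A - c \<cdot>\<^sub>m ones_mat n n = A * (1\<^sub>m n - (c / a) \<cdot>\<^sub>m ones_mat n n)"
    using A by simp
  then show ?thesis
    using A det_mult[OF A, of "1\<^sub>m n - (c / a) \<cdot>\<^sub>m ones_mat n n"]
    by (simp add: det_one_minus_ones minus_carrier_mat)
qed

text \<open>
  The Schur complement of \<open>A\<close> is explicit without inverting \<open>A\<close>: the row sums give
  \<open>A (J / a) = J\<close>, so subtracting the first block column times \<open>J / a\<close> clears the upper right
  block and leaves \<open>D - (n / a) J\<close> in the lower right corner.
\<close>

lemma det_four_block_ones:
  fixes A D :: "'a :: field mat"
  assumes A: "A \<in> carrier_mat n n" and D: "D \<in> carrier_mat m m"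
    and A1: "\<And>k. A * ones_mat n k = a \<cdot>\<^sub>m ones_mat n k" and "a \<noteq> 0"
    and D1: "\<And>k. D * ones_mat m k = d \<cdot>\<^sub>m ones_mat m k" and "d \<noteq> 0"
  shows "det (four_block_mat A (ones_mat n m) (ones_mat m n) D)
    = det A * det D * (1 - of_nat n * of_nat m / (a * d))"
proof -
  define M where "M = four_block_mat A (ones_mat n m) (ones_mat m n) D"
  define Q where "Q = four_block_mat (1\<^sub>m n) ((- 1 / a) \<cdot>\<^sub>m ones_mat n m) (0\<^sub>m m n) (1\<^sub>m m)"
  have carrier: "M \<in> carrier_mat (n + m) (n + m)" "Q \<in> carrier_mat (n + m) (n + m)"
    unfolding M_def Q_def using A D by (intro four_block_carrier_mat; simp)+
  have clear: "A * ((- 1 / a) \<cdot>\<^sub>m ones_mat n m) + ones_mat n m = 0\<^sub>m n m"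
    using A \<open>a \<noteq> 0\<close> by (subst mult_smult_distrib[where n = n]) (auto simp: A1 intro!: eq_matI)
  have schur: "ones_mat m n * ((- 1 / a) \<cdot>\<^sub>m ones_mat n m) + D
      = D - (of_nat n / a) \<cdot>\<^sub>m ones_mat m m"
    using D by (subst mult_smult_distrib[where n = n])
      (auto simp: ones_mat_mult intro!: eq_matI)
  have "M * Q = four_block_mat A (0\<^sub>m n m) (ones_mat m n) (D - (of_nat n / a) \<cdot>\<^sub>m ones_mat m m)"
    unfolding M_def Q_def using A D clear schur
    by (subst mult_four_block_mat[OF A _ _ D, where ?nc1.0 = n and ?nc2.0 = m]) auto
  moreover have "det Q = 1"
    unfolding Q_def by (subst det_four_block_mat_lower_left_zero[where n = n and m = m]) auto
  ultimately have "det M = det (four_block_mat A (0\<^sub>m n m) (ones_mat m n)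
      (D - (of_nat n / a) \<cdot>\<^sub>m ones_mat m m))"
    using det_mult[OF carrier] by simp
  also have "\<dots> = det A * det (D - (of_nat n / a) \<cdot>\<^sub>m ones_mat m m)"
    using A D by (intro det_four_block_mat_upper_right_zero) auto
  also have "det (D - (of_nat n / a) \<cdot>\<^sub>m ones_mat m m)
      = det D * (1 - of_nat n / a * of_nat m / d)"
    by (rule det_minus_ones[OF D D1 \<open>d \<noteq> 0\<close>])
  finally show ?thesis
    unfolding M_def by (simp add: mult.assoc)
qed

section \<open>Degrees\<close>

lemma vertex_degree_eq_card: "vertex_degree G u = card {v. (u, v) \<in> parcs G}"
proof -
  have "out_arcs (with_proj G) u = Pair u ` {v. (u, v) \<in> parcs G}"
    by (auto simp: out_arcs_def)
  then show ?thesis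
    by (simp add: vertex_degree_def out_degree_def card_image inj_on_def)
qed

lemma parcs_disj_union_iff [simp]:
  "(Inl u, Inl u') \<in> parcs (disj_union G H) \<longleftrightarrow> (u, u') \<in> parcs G"
  "(Inr v, Inr v') \<in> parcs (disj_union G H) \<longleftrightarrow> (v, v') \<in> parcs H"
  "(Inl u, Inr v) \<notin> parcs (disj_union G H)" "(Inr v, Inl u) \<notin> parcs (disj_union G H)"
  by (auto simp: disj_union_def)

lemma parcs_join_iff [simp]:
  "(Inl u, Inl u') \<in> parcs (join G H) \<longleftrightarrow> (u, u') \<in> parcs G"
  "(Inr v, Inr v') \<in> parcs (join G H) \<longleftrightarrow> (v, v') \<in> parcs H"
  "(Inl u, Inr v) \<in> parcs (join G H) \<longleftrightarrow> u \<in> pverts G \<and> v \<in> pverts H"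
  "(Inr v, Inl u) \<in> parcs (join G H) \<longleftrightarrow> u \<in> pverts G \<and> v \<in> pverts H"
  by (auto simp: join_def)

lemma vertex_degree_disj_union [simp]:
  "vertex_degree (disj_union G H) (Inl u) = vertex_degree G u"
  "vertex_degree (disj_union G H) (Inr v) = vertex_degree H v"
proof -
  have "{w. (Inl u, w) \<in> parcs (disj_union G H)} = Inl ` {w. (u, w) \<in> parcs G}"
    "{w. (Inr v, w) \<in> parcs (disj_union G H)} = Inr ` {w. (v, w) \<in> parcs H}"
    by (auto simp: disj_union_def)
  then show "vertex_degree (disj_union G H) (Inl u) = vertex_degree G u"
    "vertex_degree (disj_union G H) (Inr v) = vertex_degree H v"
    by (simp_all add: vertex_degree_eq_card card_image)
qed

lemma vertex_degree_join:
  assumes G: "pair_graph G" and H: "pair_graph H"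
  shows "u \<in> pverts G \<Longrightarrow> vertex_degree (join G H) (Inl u) = vertex_degree G u + graph_order H"
    and "v \<in> pverts H \<Longrightarrow> vertex_degree (join G H) (Inr v) = vertex_degree H v + graph_order G"
proof -
  have nbhd: "finite {w. (u, w) \<in> parcs K}" if "pair_graph K" for u and K :: "'c pair_pre_digraph"
    using pair_graph_props(1,2)[OF that] by (metis (no_types, lifting) finite_subset mem_Collect_eq subsetI)
  show "vertex_degree (join G H) (Inl u) = vertex_degree G u + graph_order H" if "u \<in> pverts G"
  proof -
    have "{w. (Inl u, w) \<in> parcs (join G H)} = {w. (u, w) \<in> parcs G} <+> pverts H"
      using that by (auto simp: join_def disj_union_def)
    then show ?thesis
      using nbhd[OF G] pair_graph_props(1)[OF H]
      by (simp add: vertex_degree_eq_card graph_order_def card_Plus)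
  qed
  show "vertex_degree (join G H) (Inr v) = vertex_degree H v + graph_order G" if "v \<in> pverts H"
  proof -
    have "{w. (Inr v, w) \<in> parcs (join G H)} = pverts G <+> {w. (v, w) \<in> parcs H}"
      using that by (auto simp: join_def disj_union_def)
    then show ?thesis
      using nbhd[OF H] pair_graph_props(1)[OF G]
      by (simp add: vertex_degree_eq_card graph_order_def card_Plus)
  qed
qed

lemma vertex_degree_complete_graph:
  assumes "u < m"
  shows "vertex_degree (complete_graph m) u = m - 1"
proof -
  have "{v. (u, v) \<in> parcs (complete_graph m)} = {..<m} - {u}"
    using assms by (auto simp: complete_graph_def)
  then show ?thesis
    using assms by (simp add: vertex_degree_eq_card)
qed

lemma graph_order_simps [simp]:
  "graph_order (complete_graph m) = m"
  "pair_graph G \<Longrightarrow> pair_graph H \<Longrightarrow> graph_order (disj_union G H) = graph_order G + graph_order H"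
  "pair_graph G \<Longrightarrow> pair_graph H \<Longrightarrow> graph_order (join G H) = graph_order G + graph_order H"
  by (simp_all add: graph_order_def complete_graph_def join_def disj_union_def card_Plus pair_graph_props(1))

definition degree_sum :: "'a pair_pre_digraph \<Rightarrow> nat" where
  "degree_sum G = (\<Sum>v\<in>pverts G. vertex_degree G v)"

lemma average_degree_eq: "average_degree G = real (degree_sum G) / real (graph_order G)"
  by (simp add: average_degree_def degree_sum_def)

lemma degree_sum_complete_graph: "degree_sum (complete_graph m) = m * (m - 1)"
proof -
  have "degree_sum (complete_graph m) = (\<Sum>v<m. m - 1)"
    unfolding degree_sum_def
    by (rule sum.cong) (simp add: complete_graph_def, simp add: vertex_degree_complete_graph)
  then show ?thesis by simp
qed

lemma degree_sum_disj_union: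
  assumes "pair_graph G" "pair_graph H"
  shows "degree_sum (disj_union G H) = degree_sum G + degree_sum H"
proof -
  have "pverts (disj_union G H) = pverts G <+> pverts H"
    by (simp add: disj_union_def)
  then show ?thesis
    using assms[THEN pair_graph_props(1)] by (simp add: degree_sum_def sum.Plus)
qed

lemma degree_sum_join:
  assumes "pair_graph G" "pair_graph H"
  shows "degree_sum (join G H) = degree_sum G + degree_sum H + 2 * graph_order G * graph_order H"
proof -
  have "pverts (join G H) = pverts G <+> pverts H"
    by (simp add: join_def disj_union_def)
  then show ?thesis
    using assms[THEN pair_graph_props(1)]
    by (simp add: degree_sum_def sum.Plus vertex_degree_join[OF assms] sum.distrib graph_order_def)
qed

section \<open>Laplacian characteristic polynomials\<close>

text \<open>
  Uses the enumeration that \<^const>\<open>laplacian_spectrum\<close> chooses; by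
  \<open>poly_laplacian_char_poly\<close> every other enumeration gives the same polynomial.
\<close>

definition laplacian_char_poly :: "'a pair_pre_digraph \<Rightarrow> real poly" where
  "laplacian_char_poly G = char_poly (laplacian_matrix (SOME vs. vertex_enum G vs) G)"

lemma vertex_enum_exists:
  assumes "pair_graph G"
  obtains vs where "vertex_enum G vs" "length vs = graph_order G"
  using finite_distinct_list[OF pair_graph_props(1)[OF assms]] distinct_card
  by (metis graph_order_def vertex_enum_def)

lemma laplacian_matrix_carrier [simp, intro]:
  "laplacian_matrix vs G \<in> carrier_mat (length vs) (length vs)"
  by (intro carrier_matI) (simp_all add: laplacian_matrix_def degree_matrix_def adjacency_matrix_def)

lemma laplacian_matrix_dim [simp]:
  "dim_row (laplacian_matrix vs G) = length vs" "dim_col (laplacian_matrix vs G) = length vs"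
  by (rule carrier_matD[OF laplacian_matrix_carrier])+

lemma laplacian_matrix_index:
  assumes "i < length vs" "j < length vs"
  shows "laplacian_matrix vs G $$ (i, j)
    = (if i = j then real (vertex_degree G (vs ! i)) else 0) - (if (vs ! i, vs ! j) \<in> parcs G then 1 else 0)"
  using assms by (simp add: laplacian_matrix_def degree_matrix_def adjacency_matrix_def)

lemma poly_laplacian_char_poly:
  assumes "vertex_enum G vs"
  shows "poly (laplacian_char_poly G) x = det (x \<cdot>\<^sub>m 1\<^sub>m (length vs) - laplacian_matrix vs G)"
proof -
  have "laplacian_char_poly G = char_poly (laplacian_matrix vs G)"
    unfolding laplacian_char_poly_def
    by (rule char_poly_laplacian_matrix_enum) (use assms in \<open>auto intro: someI\<close>)
  moreover have "- char_matrix (laplacian_matrix vs G) x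
      = x \<cdot>\<^sub>m 1\<^sub>m (length vs) - laplacian_matrix vs G"
    by (intro eq_matI) (auto simp: char_matrix_def)
  ultimately show ?thesis
    by (simp add: char_poly_matrix[OF laplacian_matrix_carrier])
qed

text \<open>
  The Laplacian annihilates the all-ones vector, which is what the determinant formulas for
  matrices with constant row sums require of \<open>x I - L\<close>.
\<close>

lemma laplacian_row_sums:
  assumes G: "pair_graph G" and vs: "vertex_enum G vs"
  shows "(x \<cdot>\<^sub>m 1\<^sub>m (length vs) - laplacian_matrix vs G) * ones_mat (length vs) k
    = x \<cdot>\<^sub>m ones_mat (length vs) k"
proof (intro eq_matI)
  fix i j assume "i < dim_row (x \<cdot>\<^sub>m ones_mat (length vs) k)"
    "j < dim_col (x \<cdot>\<^sub>m ones_mat (length vs) k)"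
  then have i: "i < length vs" and j: "j < k" by simp_all
  have en: "distinct vs" "set vs = pverts G" using vs by (auto simp: vertex_enum_def)
  have "(\<Sum>l<length vs. if (vs ! i, vs ! l) \<in> parcs G then 1 else (0::real))
      = (\<Sum>v\<in>set vs. if (vs ! i, v) \<in> parcs G then 1 else 0)"
    using bij_betw_nth[OF en(1) refl refl]
    by (rule sum.reindex_bij_betw)
  also have "\<dots> = (\<Sum>v\<in>{v. (vs ! i, v) \<in> parcs G}. 1)"
    using pair_graph_props(1,2)[OF G] en by (intro sum.mono_neutral_cong_right) auto
  also have "\<dots> = real (vertex_degree G (vs ! i))"
    by (simp add: vertex_degree_eq_card)
  finally have adj: "(\<Sum>l<length vs. if (vs ! i, vs ! l) \<in> parcs G then 1 else (0::real))
      = real (vertex_degree G (vs ! i))" .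
  have "((x \<cdot>\<^sub>m 1\<^sub>m (length vs) - laplacian_matrix vs G) * ones_mat (length vs) k) $$ (i, j)
      = (\<Sum>l<length vs. (if i = l then x else 0) - ((if i = l then real (vertex_degree G (vs ! i)) else 0)
          - (if (vs ! i, vs ! l) \<in> parcs G then 1 else 0)))"
    using i j by (auto simp: scalar_prod_def atLeast0LessThan laplacian_matrix_index intro!: sum.cong)
  also have "\<dots> = x"
    using i adj by (simp add: sum_subtractf)
  finally show "((x \<cdot>\<^sub>m 1\<^sub>m (length vs) - laplacian_matrix vs G) * ones_mat (length vs) k) $$ (i, j)
      = (x \<cdot>\<^sub>m ones_mat (length vs) k) $$ (i, j)"
    using i j by simp
qed simp_all

lemma vertex_enum_Plus:
  assumes "vertex_enum G us" "vertex_enum H vs"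
  shows "vertex_enum (disj_union G H) (map Inl us @ map Inr vs)"
    and "vertex_enum (join G H) (map Inl us @ map Inr vs)"
  using assms by (auto simp: vertex_enum_def join_def disj_union_def distinct_map)

lemma laplacian_char_poly_disj_union:
  assumes G: "pair_graph G" and H: "pair_graph H"
  shows "poly (laplacian_char_poly (disj_union G H)) x
    = poly (laplacian_char_poly G) x * poly (laplacian_char_poly H) x"
proof -
  obtain us vs where us: "vertex_enum G us" and vs: "vertex_enum H vs"
    using vertex_enum_exists G H by metis
  let ?n = "length us" and ?m = "length vs"
  have "x \<cdot>\<^sub>m 1\<^sub>m (?n + ?m) - laplacian_matrix (map Inl us @ map Inr vs) (disj_union G H)
      = four_block_mat (x \<cdot>\<^sub>m 1\<^sub>m ?n - laplacian_matrix us G) (0\<^sub>m ?n ?m)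
          (0\<^sub>m ?m ?n) (x \<cdot>\<^sub>m 1\<^sub>m ?m - laplacian_matrix vs H)"
    by (intro eq_matI) (auto simp: laplacian_matrix_index nth_append)
  then have "det (x \<cdot>\<^sub>m 1\<^sub>m (?n + ?m) - laplacian_matrix (map Inl us @ map Inr vs) (disj_union G H))
      = det (x \<cdot>\<^sub>m 1\<^sub>m ?n - laplacian_matrix us G) * det (x \<cdot>\<^sub>m 1\<^sub>m ?m - laplacian_matrix vs H)"
    by (simp, subst det_four_block_mat_upper_right_zero) auto
  then show ?thesis
    by (simp add: poly_laplacian_char_poly[OF us] poly_laplacian_char_poly[OF vs]
        poly_laplacian_char_poly[OF vertex_enum_Plus(1)[OF us vs]])
qed

text \<open>
  The arguments \<open>x - h\<close> and \<open>x - g\<close> are the shifts of the two spectra; the last factor removes the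
  shifted zero eigenvalues \<open>h\<close> and \<open>g\<close> and inserts \<open>0\<close> and \<open>g + h\<close> instead.
\<close>

lemma laplacian_char_poly_join:
  assumes G: "pair_graph G" and H: "pair_graph H"
    and x: "x \<noteq> real (graph_order G)" "x \<noteq> real (graph_order H)"
  shows "poly (laplacian_char_poly (join G H)) x
    = poly (laplacian_char_poly G) (x - graph_order H) * poly (laplacian_char_poly H) (x - graph_order G)
      * (x * (x - graph_order G - graph_order H) / ((x - graph_order G) * (x - graph_order H)))"
proof -
  obtain us vs where us: "vertex_enum G us" "length us = graph_order G"
    and vs: "vertex_enum H vs" "length vs = graph_order H"
    using vertex_enum_exists G H by metis
  let ?n = "length us" and ?m = "length vs"
  define A where "A = (x - ?m) \<cdot>\<^sub>m 1\<^sub>m ?n - laplacian_matrix us G"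
  define D where "D = (x - ?n) \<cdot>\<^sub>m 1\<^sub>m ?m - laplacian_matrix vs H"
  have in_verts: "i < ?n \<Longrightarrow> us ! i \<in> pverts G" "j < ?m \<Longrightarrow> vs ! j \<in> pverts H" for i j
    using us vs nth_mem by (fastforce simp: vertex_enum_def)+
  have "x \<cdot>\<^sub>m 1\<^sub>m (?n + ?m) - laplacian_matrix (map Inl us @ map Inr vs) (join G H)
      = four_block_mat A (ones_mat ?n ?m) (ones_mat ?m ?n) D"
    unfolding A_def D_def
    by (intro eq_matI) (auto simp: laplacian_matrix_index nth_append vertex_degree_join[OF G H] in_verts
      us(2) vs(2))
  then have "poly (laplacian_char_poly (join G H)) x
      = det (four_block_mat A (ones_mat ?n ?m) (ones_mat ?m ?n) D)"
    by (simp add: poly_laplacian_char_poly[OF vertex_enum_Plus(2)[OF us(1) vs(1)]])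
  also have "\<dots> = det A * det D * (1 - real ?n * real ?m / ((x - ?m) * (x - ?n)))"
    unfolding A_def D_def using x us(2) vs(2)
    by (intro det_four_block_ones laplacian_row_sums[OF G us(1)] laplacian_row_sums[OF H vs(1)]) auto
  also have "1 - real ?n * real ?m / ((x - ?m) * (x - ?n))
      = x * (x - ?n - ?m) / ((x - ?n) * (x - ?m))"
  proof -
    have "1 - a * b / ((x - b) * (x - a)) = x * (x - a - b) / ((x - a) * (x - b))"
      if "x \<noteq> a" "x \<noteq> b" for a b
      using that by (simp add: divide_simps) (simp add: algebra_simps)
    then show ?thesis
      using x us(2) vs(2) by simp
  qed
  finally show ?thesis
    by (simp add: A_def D_def poly_laplacian_char_poly[OF us(1)] poly_laplacian_char_poly[OF vs(1)] us(2) vs(2))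
qed

lemma laplacian_char_poly_complete_graph:
  assumes "m \<ge> 1" "x \<noteq> real m"
  shows "poly (laplacian_char_poly (complete_graph m)) x = x * (x - m) ^ (m - 1)"
proof -
  let ?vs = "[0..<m]"
  have en: "vertex_enum (complete_graph m) ?vs"
    by (auto simp: vertex_enum_def complete_graph_def)
  \<comment> \<open>The Laplacian of \<open>K\<^sub>m\<close> is \<open>m I - J\<close>.\<close>
  have "x \<cdot>\<^sub>m 1\<^sub>m m - laplacian_matrix ?vs (complete_graph m)
      = (x - m) \<cdot>\<^sub>m 1\<^sub>m m - (- 1) \<cdot>\<^sub>m ones_mat m m"
    using assms(1)
    by (intro eq_matI) (auto simp: laplacian_matrix_index vertex_degree_complete_graph,
      auto simp: complete_graph_def)
  then have "poly (laplacian_char_poly (complete_graph m)) x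
      = det ((x - m) \<cdot>\<^sub>m 1\<^sub>m m - (- 1) \<cdot>\<^sub>m ones_mat m m)"
    using poly_laplacian_char_poly[OF en, of x] by simp
  also have "\<dots> = det ((x - m) \<cdot>\<^sub>m 1\<^sub>m m) * (1 - (- 1) * of_nat m / (x - m))"
    using assms(2) by (intro det_minus_ones) (auto simp: mult_smult_assoc_mat[where n = m])
  also have "\<dots> = x * (x - m) ^ (m - 1)"
    using assms by (cases m) (simp_all add: field_simps)
  finally show ?thesis .
qed

section \<open>Laplacian spectra\<close>

lemma poly_eqI_cofinite:
  fixes p q :: "'a :: {comm_ring_1, ring_no_zero_divisors, ring_char_0} poly"
  assumes "finite S" "\<And>x. x \<notin> S \<Longrightarrow> poly p x = poly q x"
  shows "p = q"
proof (rule ccontr)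
  assume "p \<noteq> q"
  then have "finite ({x. poly (p - q) x = 0} \<union> S)"
    using assms(1) by (intro finite_UnI poly_roots_finite) auto
  moreover have "{x. poly (p - q) x = 0} \<union> S = UNIV"
    using assms(2) by auto
  ultimately show False
    using infinite_UNIV_char_0 by metis
qed

lemma proots_prod_linear: "proots (\<Prod>a\<in>#A. [:- a, 1:]) = (A :: 'a :: idom multiset)"
proof (induction A)
  case (add a A)
  have "(\<Prod>a\<in>#A. [:- a, 1:]) \<noteq> 0"
    by (auto simp: prod_mset_zero_iff)
  then show ?case
    using add by (simp add: proots_mult del: mult_pCons_left)
qed simp

lemma laplacian_spectrum_eqI:
  assumes "finite S" "\<And>x. x \<notin> S \<Longrightarrow> poly (laplacian_char_poly G) x = (\<Prod>a\<in>#A. x - a)"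
  shows "laplacian_spectrum G = A"
proof -
  have "poly (\<Prod>a\<in>#A. [:- a, 1:]) x = (\<Prod>a\<in>#A. x - a)" for x
    by (induction A) (simp_all del: mult_pCons_left)
  then have "laplacian_char_poly G = (\<Prod>a\<in>#A. [:- a, 1:])"
    by (intro poly_eqI_cofinite[OF assms(1)]) (simp add: assms(2))
  then show ?thesis
    by (simp add: laplacian_spectrum_def laplacian_char_poly_def[symmetric] proots_prod_linear)
qed

lemma laplacian_spectrum_complete_graph:
  assumes "m \<ge> 1"
  shows "laplacian_spectrum (complete_graph m) = add_mset 0 (replicate_mset (m - 1) (real m))"
  using assms
  by (intro laplacian_spectrum_eqI[where S = "{real m}"])
    (simp_all add: laplacian_char_poly_complete_graph)

lemma laplacian_spectrum_complete_coalescence: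
  assumes "n \<ge> 3"
  shows "laplacian_spectrum (complete_coalescence n)
    = {#0, 1, 2 * real n - 2#} + replicate_mset (n - 2) (real n) + replicate_mset (n - 3) (real n - 1)"
    (is "_ = ?A")
proof (rule laplacian_spectrum_eqI)
  \<comment> \<open>The exceptional points are those where a factor of the join formula, or the formula for one
    of the complete graphs at its shifted argument, is not available.\<close>
  let ?U = "disj_union (complete_graph (n - 1)) (complete_graph (n - 2))"
  show "finite {1, real n - 1, real n, 2 * real n - 3, 2 * real n - 2}"
    by simp
  fix x :: real
  assume x: "x \<notin> {1, real n - 1, real n, 2 * real n - 3, 2 * real n - 2}"
  have U: "poly (laplacian_char_poly ?U) (x - 1)
      = (x - 1)\<^sup>2 * (x - n) ^ (n - 2) * (x - n + 1) ^ (n - 3)"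
    using assms x
    by (simp add: laplacian_char_poly_disj_union pair_graph_complete_graph
        laplacian_char_poly_complete_graph of_nat_diff power2_eq_square numeral_eq_Suc algebra_simps)
  have K: "poly (laplacian_char_poly (complete_graph 1)) (x - (2 * real n - 3)) = x - (2 * real n - 3)"
    using x by (subst laplacian_char_poly_complete_graph) auto
  have order: "real (graph_order ?U) = 2 * real n - 3"
    using assms by (simp add: pair_graph_complete_graph of_nat_diff)
  have "poly (laplacian_char_poly (complete_coalescence n)) x
      = (x - 1)\<^sup>2 * (x - n) ^ (n - 2) * (x - n + 1) ^ (n - 3) * (x - (2 * real n - 3))
        * (x * (x - (2 * real n - 3) - 1) / ((x - (2 * real n - 3)) * (x - 1)))"
    unfolding complete_coalescence_def
    using x U K order
    by (subst laplacian_char_poly_join)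
      (auto simp: pair_graph_complete_graph pair_graph_disj_union simp del: graph_order_simps(2))
  also have "\<dots> = x * (x - 1) * (x - (2 * real n - 2)) * (x - n) ^ (n - 2) * (x - (real n - 1)) ^ (n - 3)"
    using x by (simp add: power2_eq_square divide_simps) (simp add: algebra_simps)
  also have "\<dots> = (\<Prod>a\<in>#?A. x - a)"
    by simp
  finally show "poly (laplacian_char_poly (complete_coalescence n)) x = (\<Prod>a\<in>#?A. x - a)" .
qed

section \<open>Energy\<close>

lemma graph_order_complete_coalescence:
  assumes "n \<ge> 2"
  shows "graph_order (complete_coalescence n) = 2 * n - 2"
  using assms
  by (simp add: complete_coalescence_def pair_graph_complete_graph pair_graph_disj_union)

lemma average_degree_complete_coalescence:
  assumes "n \<ge> 2"
  shows "average_degree (complete_coalescence n) = real n - 1"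
proof -
  obtain k where n: "n = k + 2"
    using assms by (metis add.commute le_Suc_ex)
  have "degree_sum (complete_coalescence n) = (k + 1) * graph_order (complete_coalescence n)"
    by (simp add: n complete_coalescence_def pair_graph_complete_graph pair_graph_disj_union
        degree_sum_join degree_sum_disj_union degree_sum_complete_graph)
      (cases k; simp add: algebra_simps)
  moreover have "graph_order (complete_coalescence n) > 0"
    using assms by (simp add: graph_order_complete_coalescence)
  ultimately show ?thesis
    by (simp add: average_degree_eq n field_simps)
qed

theorem theorem3:
  fixes n :: nat
  assumes "n \<ge> 3"
  shows "graph_order (complete_coalescence n) = 2 * n - 2
    \<and> L_borderenergetic (complete_coalescence n)
    \<and> L_noncospectral (complete_coalescence n) (complete_graph (2 * n - 2))"
proof (intro conjI)
  show order: "graph_order (complete_coalescence n) = 2 * n - 2"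
    using assms by (simp add: graph_order_complete_coalescence)
  have "laplacian_energy (complete_coalescence n) = 4 * real n - 6"
    using assms
    by (simp add: laplacian_energy_def laplacian_spectrum_complete_coalescence
        average_degree_complete_coalescence of_nat_diff)
  then show "L_borderenergetic (complete_coalescence n)"
    using assms by (simp add: L_borderenergetic_def order of_nat_diff)
  \<comment> \<open>The zero eigenvalue of multiplicity two of the disconnected graph
    \<open>K\<^bsub>n-1\<^esub> \<union> K\<^bsub>n-2\<^esub>\<close>, shifted by the order of \<open>K\<^sub>1\<close>, survives once.\<close>
  have "1 \<in># laplacian_spectrum (complete_coalescence n)"
    using assms by (simp add: laplacian_spectrum_complete_coalescence)
  moreover have "1 \<notin># laplacian_spectrum (complete_graph (2 * n - 2))"
    using assms by (simp add: laplacian_spectrum_complete_graph of_nat_diff)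
  ultimately show "L_noncospectral (complete_coalescence n) (complete_graph (2 * n - 2))"
    by (auto simp: L_noncospectral_def)
qed

end
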